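(* Let $t_0,t_1,\dots,t_6\in\mathbb{C}[[q]]$ be the formal power series solution of the differential system displayed in the context, with $t_{0,0}=\frac15$, $t_{0,1}=24$, $t_{4,0}=0$ and $t_{5,0}\neq 0$. Then $$\frac{-(t_4-t_0^5)^2}{625\,t_5^3}$$ is the Yukawa coupling associated to the family of Calabi-Yau varieties $W_\psi$. That is, it is equal, as a power series in $q=e^{2\pi i\tau}$, to the $q$-expansion of the function $k_{\tau\tau\tau}$ defined in the context.
   Context: **The differential system.** Write $\dot t=5q\frac{\partial t}{\partial q}$. The system is $$\begin{aligned} \dot t_0&=\tfrac{1}{t_5}\left(\tfrac{6}{5}t_0^5+\tfrac{1}{3125}t_0t_3-\tfrac{1}{5}t_4\right)\\ \dot t_1&=\tfrac{1}{t_5}\left(-125t_0^6+t_0^4t_1+125t_0t_4+\tfrac{1}{3125}t_1t_3\right)\\ \dot t_2&=\tfrac{1}{t_5}\left(-1875t_0^7-\tfrac{1}{5}t_0^5t_1+2t_0^4t_2+1875t_0^2t_4+\tfrac{1}{5}t_1t_4+\tfrac{2}{3125}t_2t_3\right)\\ \dot t_3&=\tfrac{1}{t_5}\left(-3125t_0^8-\tfrac{1}{5}t_0^5t_2+3t_0^4t_3+3125t_0^3t_4+\tfrac{1}{5}t_2t_4+\tfrac{3}{3125}t_3^2\right)\\ \dot t_4&=\tfrac{1}{t_5}\left(5t_0^4t_4+\tfrac{1}{625}t_3t_4\right)\\ \dot t_5&=\tfrac{t_6}{t_5}\\ \dot t_6&=\left(-\tfrac{72}{5}t_0^8-\tfrac{24}{3125}t_0^4t_3-\tfrac{3}{5}t_0^3t_4-\tfrac{2}{1953125}t_3^2\right)+\tfrac{t_6}{t_5}\left(12t_0^4+\tfrac{2}{625}t_3\right)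 \end{aligned}$$ Write $t_i=\sum_{n\ge0}t_{i,n}q^n$. The conditions $t_{0,0}=\frac15$, $t_{0,1}=24$, $t_{4,0}=0$, $t_{5,0}\ne0$ determine all coefficients $t_{i,n}$ uniquely (in particular $t_{5,0}=-\frac1{3125}$). **The family.** $W_\psi$ is the variety obtained by resolution of singularities of the quotient of the hypersurface $\{x_0^5+x_1^5+x_2^5+x_3^5+x_4^5-5\psi x_0x_1x_2x_3x_4=0\}\subset\mathbb{P}^4$ by the group $G=\{(\zeta_1,\dots,\zeta_5)\mid \zeta_i^5=1,\ \zeta_1\zeta_2\zeta_3\zeta_4\zeta_5=1\}$ acting diagonally on the coordinates. It is a Calabi-Yau threefold (mirror to the quintic). Put $z=\psi^{-5}$; in the chart $x_0=1$ the variety is described (after rescaling the coordinates) by $f=0$ modulo $G$, with $f=-z-x_1^5-x_2^5-x_3^5-x_4^5+5x_1x_2x_3x_4$, and $\eta=\frac{dx_1\wedge dx_2\wedge dx_3\wedge dx_4}{df}$ is the induced holomorphic $3$-form. **Periods near $z=0$.** Put $\tilde z=z/5^5$. There are cycles $\delta_1,\delta_2$ in $H_3(W_\psi,\mathbb{Q})$ with $$\int_{\delta_1}\eta=\frac{(2\pi i)^3}{5^4}h_0(\tilde z),\qquad \int_{\delta_2}\eta=\frac{(2\pi i)^2}{5^4}h_1(\tilde z),$$ where $$h_0=\sum_{m\ge0}\frac{(5m)!}{(m!)^5}\tilde z^m,\qquad h_1=\ln(\tilde z)\,h_0+5\sum_{m\ge1}\frac{(5m)!}{(m!)^5}\Big(\sum_{k=m+1}^{5m}\frac1k\Big)\tilde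 z^m .$$ **The Yukawa coupling.** Let $\tau=\frac{\int_{\delta_2}\eta}{\int_{\delta_1}\eta}$, $q=e^{2\pi i\tau}=\tilde z+O(\tilde z^2)$ (a local coordinate at $z=0$), and $a=\frac{2\pi i}{5}$. The Yukawa coupling is $$k_{\tau\tau\tau}=\frac{-5^{-4}a^3}{\left(z\frac{\partial\tau}{\partial z}\right)^3(z-1)\left(\int_{\delta_1}\eta\right)^2},$$ regarded as a power series in $q$. Equivalently, $$k_{\tau\tau\tau}=\frac{5}{(1-z)h_0^2}\left(\frac{q}{z}\frac{dz}{dq}\right)^3 .$$ *)

theory Defs
  imports "HOL-Complex_Analysis.Complex_Analysis"
begin

text \<open>
  The constant term of \<open>t5\<close> is required to be nonzero wherever this is used, so that every
  division by \<open>t5\<close> below is multiplication by an inverse power series.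
\<close>

definition qdot :: "complex fps \<Rightarrow> complex fps" where
  "qdot t = 5 * (fps_X * fps_deriv t)"

definition quintic_system ::
  "complex fps \<Rightarrow> complex fps \<Rightarrow> complex fps \<Rightarrow> complex fps \<Rightarrow> complex fps \<Rightarrow> complex fps \<Rightarrow>
   complex fps \<Rightarrow> bool" where
  "quintic_system t0 t1 t2 t3 t4 t5 t6 \<longleftrightarrow>
     qdot t0 = (fps_const (6/5) * t0^5 + fps_const (1/3125) * t0 * t3 - fps_const (1/5) * t4) / t5 \<and>
     qdot t1 = (- 125 * t0^6 + t0^4 * t1 + 125 * t0 * t4 + fps_const (1/3125) * t1 * t3) / t5 \<and>
     qdot t2 = (- 1875 * t0^7 - fps_const (1/5) * t0^5 * t1 + 2 * t0^4 * t2 + 1875 * t0^2 * t4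
                + fps_const (1/5) * t1 * t4 + fps_const (2/3125) * t2 * t3) / t5 \<and>
     qdot t3 = (- 3125 * t0^8 - fps_const (1/5) * t0^5 * t2 + 3 * t0^4 * t3 + 3125 * t0^3 * t4
                + fps_const (1/5) * t2 * t4 + fps_const (3/3125) * t3^2) / t5 \<and>
     qdot t4 = (5 * t0^4 * t4 + fps_const (1/625) * t3 * t4) / t5 \<and>
     qdot t5 = t6 / t5 \<and>
     qdot t6 = (fps_const (- 72/5) * t0^8 - fps_const (24/3125) * t0^4 * t3
                - fps_const (3/5) * t0^3 * t4 - fps_const (2/1953125) * t3^2)
               + t6 / t5 * (12 * t0^4 + fps_const (2/625) * t3)"

definition hyp0 :: "complex \<Rightarrow> complex" where
  "hyp0 u = (\<Sum>m. fact (5 * m) / fact m ^ 5 * u ^ m)"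

text \<open>
  The logarithm is the principal branch. The \<open>m = 0\<close> term of the series vanishes because its
  inner sum is empty.
\<close>

definition hyp1 :: "complex \<Rightarrow> complex" where
  "hyp1 u = Ln u * hyp0 u +
     5 * (\<Sum>m. fact (5 * m) / fact m ^ 5 * (\<Sum>k = Suc m..5 * m. 1 / of_nat k) * u ^ m)"

text \<open>
  In the next three definitions \<open>P1\<close> and \<open>P2\<close> are the periods of the holomorphic 3-form over the
  two cycles, as functions of the parameter \<open>z\<close> of the family.
\<close>

definition tau_map :: "(complex \<Rightarrow> complex) \<Rightarrow> (complex \<Rightarrow> complex) \<Rightarrow> complex \<Rightarrow> complex" where
  "tau_map P1 P2 z = P2 z / P1 z"

definition q_map :: "(complex \<Rightarrow> complex) \<Rightarrow> (complex \<Rightarrow> complex) \<Rightarrow> complex \<Rightarrow> complex" where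
  "q_map P1 P2 z = exp (2 * of_real pi * \<i> * tau_map P1 P2 z)"

definition yukawa :: "(complex \<Rightarrow> complex) \<Rightarrow> (complex \<Rightarrow> complex) \<Rightarrow> complex \<Rightarrow> complex" where
  "yukawa P1 P2 z =
     (- (1 / 5 ^ 4) * (2 * of_real pi * \<i> / 5) ^ 3) /
     ((z * deriv (tau_map P1 P2) z) ^ 3 * (z - 1) * (P1 z) ^ 2)"

text \<open>
  The logarithmic period is multivalued around \<open>z = 0\<close>, so \<open>z\<close> tends to \<open>0\<close> off the branch cut.
  The values of \<open>q\<close> taken there accumulate at \<open>0\<close>, so \<open>F\<close> is determined by \<open>q\<close> and \<open>k\<close>.
\<close>

definition has_q_expansion ::
  "(complex \<Rightarrow> complex) \<Rightarrow> (complex \<Rightarrow> complex) \<Rightarrow> complex fps \<Rightarrow> bool" where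
  "has_q_expansion q k F \<longleftrightarrow>
     (\<exists>K. K has_fps_expansion F \<and>
          (\<forall>\<^sub>F z in at 0 within - \<real>\<^sub>\<le>\<^sub>0. k z = K (q z)))"

end

theory Submission
  imports Defs
begin

text \<open>
  Put \<open>z = t4 / t0^5\<close> and let \<open>\<theta>\<close> be the multiple of \<open>q d/dq\<close> with \<open>\<theta> z = z\<close>; by the equations for
  \<open>t0\<close> and \<open>t4\<close> it is \<open>\<theta> = E q d/dq\<close> with \<open>5 t5 = t0^4 (z - 1) E\<close>. In terms of \<open>\<theta>\<close> the first five
  equations eliminate \<open>t1\<close>, \<open>t2\<close>, \<open>t3\<close> and leave the Picard-Fuchs equation for \<open>t0\<close>, whose only
  power series solution gives \<open>t0 = h0 / 5\<close>; the coefficient of \<open>q\<close> forces \<open>z = 5^5 q + O(q^2)\<close>. The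
  last two equations become a second order linear equation for \<open>w = t0^2 E\<close>. The Wronskian
  \<open>h0 \<theta> h1 - h1 \<theta> h0\<close> satisfies the same equation: it does so because \<open>h0\<close>, \<open>h1\<close> span a
  Lagrangian plane for the symplectic form on the solutions of the Picard-Fuchs equation. Hence
  \<open>E = \<theta> (h1 / h0)\<close>, that is, \<open>q = exp (h1 / h0)\<close>, and the formula for the Yukawa coupling follows by
  substitution. The formal identities carry over to functions because \<open>exp (h1 / h0)\<close> is locally
  invertible at \<open>0\<close>.
\<close>

section \<open>Elimination in the differential system\<close>

text \<open>Additivity and the Leibniz rule alone make integers constant. The elimination runs over
  an abstract domain, hence the integer coefficients in the lemmas below.\<close>

locale derivation =
  fixes d :: "'a::comm_ring_1 \<Rightarrow> 'a"
  assumes add: "d (x + y) = d x + d y"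
    and mult: "d (x * y) = d x * y + x * d y"
begin

lemma one [simp]: "d 1 = 0"
  using mult[of 1 1] by simp

lemma zero [simp]: "d 0 = 0"
  using add[of 0 0] by simp

lemma minus: "d (- x) = - d x"
  using add[of x "- x"] by (simp add: add_eq_0_iff)

lemma diff: "d (x - y) = d x - d y"
  using add[of x "- y"] by (simp add: minus)

lemma of_nat [simp]: "d (of_nat n) = 0"
  by (induction n) (simp_all add: add)

lemma numeral [simp]: "d (numeral n) = 0"
  using of_nat[of "numeral n"] by (simp del: of_nat)

lemma numeral_mult [simp]: "d (numeral n * x) = numeral n * d x"
  by (simp add: mult)

lemma power2: "d (x ^ 2) = 2 * x * d x"
  by (simp add: power2_eq_square mult algebra_simps)

lemma power3: "d (x ^ 3) = 3 * x ^ 2 * d x"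
  by (simp add: power3_eq_cube power2_eq_square mult algebra_simps)

lemma power4: "d (x ^ 4) = 4 * x ^ 3 * d x"
proof -
  have "x ^ 4 = (x ^ 2) ^ 2" by simp
  then show ?thesis
    by (simp only: power2) (simp add: algebra_simps eval_nat_numeral)
qed

lemma power5: "d (x ^ 5) = 5 * x ^ 4 * d x"
proof -
  have "x ^ 5 = x * x ^ 4" by (simp add: eval_nat_numeral)
  then show ?thesis
    by (simp only: mult power4) (simp add: algebra_simps eval_nat_numeral)
qed

end


text \<open>The system is quasi-homogeneous with weights 1 to 5 for \<open>t0\<close> to
  \<open>t4\<close>. Scaling \<open>t1\<close>, \<open>t2\<close>, \<open>t3\<close> back to the
  weight of \<open>y\<close> gives \<open>a\<close>, \<open>b\<close>, \<open>c\<close>, in which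
  the equations become linear over polynomials in \<open>z\<close>.\<close>

lemma picard_fuchs_from_system:
  fixes d :: "'a::{idom,semiring_char_0} \<Rightarrow> 'a"
  assumes der: "derivation d" and y: "y \<noteq> 0" and z1: "z \<noteq> 1"
    and t1: "t1 = y * a" and t2: "t2 = y^2 * b" and t3: "t3 = y^3 * c" and t4: "t4 = y^5 * z"
    and y1: "y1 = d y" and y2: "y2 = d y1" and y3: "y3 = d y2" and y4: "y4 = d y3"
    and e0: "3125 * y^4 * (z - 1) * d y = 3750 * y^5 + y * t3 - 625 * t4"
    and e1: "3125 * y^4 * (z - 1) * d t1 = - 390625 * y^6 + 3125 * y^4 * t1 + 390625 * y * t4 + t1 * t3"
    and e2: "3125 * y^4 * (z - 1) * d t2 = - 5859375 * y^7 - 625 * y^5 * t1 + 6250 * y^4 * t2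
                + 5859375 * y^2 * t4 + 625 * t1 * t4 + 2 * t2 * t3"
    and e3: "3125 * y^4 * (z - 1) * d t3 = - 9765625 * y^8 - 625 * y^5 * t2 + 9375 * y^4 * t3
                + 9765625 * y^3 * t4 + 625 * t2 * t4 + 3 * t3^2"
    and e4: "625 * y^4 * (z - 1) * d t4 = 3125 * y^4 * t4 + t3 * t4"
  shows "d z = z"
    and "625 * (1 - z) * y4 = z * (1250 * y3 + 875 * y2 + 250 * y1 + 24 * y)"
    and "t3 = 3125 * y^3 * (z - 1) * y1 + 625 * y^4 * (z - 6)"
proof -
  interpret derivation d by fact
  show dz: "d z = z"
  proof -
    \<comment> \<open>Expand \<open>d (y^5 * z)\<close> in \<open>e4\<close> and remove
      \<open>d y\<close> by \<open>e0\<close>; the \<open>t3\<close> terms cancel.\<close>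
    have "625 * y^9 * (z - 1) * d z = 625 * y^9 * (z - 1) * z"
      using e0 e4 unfolding t4 mult power5 by algebra
    moreover have "625 * y^9 * (z - 1) \<noteq> 0"
      using y z1 by simp
    ultimately show ?thesis by (rule mult_left_cancel[THEN iffD1, rotated])
  qed
  note d_rules = add diff minus mult power2 power3 power4 power5 dz y1[symmetric] y2[symmetric] y3[symmetric] y4[symmetric]
  have c: "c = 3125 * (z - 1) * y1 + 625 * y * (z - 6)"
  proof -
    have "y^4 * c = y^4 * (3125 * (z - 1) * y1 + 625 * y * (z - 6))"
      using e0 unfolding y1[symmetric] t3 t4 by algebra
    then show ?thesis using y by simp
  qed
  have nz: "625 * y^n * (z - 1) \<noteq> 0" for n
    using y z1 by simp
  \<comment> \<open>The chain is solved backwards: \<open>e3\<close> gives \<open>b\<close>,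
    \<open>e2\<close> gives \<open>a\<close>, and \<open>e1\<close> closes it as an equation of
    order four for \<open>y\<close>. Each time the formula for \<open>c\<close> cancels the
    quadratic terms, and a factor \<open>z - 1\<close> divides out.\<close>
  have db: "5 * d c = 15625 * y + b + 3 * c"
  proof -
    have "625 * y^7 * (z - 1) * (5 * d c) = 625 * y^7 * (z - 1) * (15625 * y + b + 3 * c)"
      using e3 c unfolding t3 t2 t4 mult power3 y1[symmetric] by algebra
    then show ?thesis by (rule mult_left_cancel[OF nz, THEN iffD1])
  qed
  have da: "5 * d b = 9375 * y + a + 2 * b"
  proof -
    have "625 * y^6 * (z - 1) * (5 * d b) = 625 * y^6 * (z - 1) * (9375 * y + a + 2 * b)"
      using e2 c unfolding t3 t2 t1 t4 mult power2 y1[symmetric] by algebra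
    then show ?thesis by (rule mult_left_cancel[OF nz, THEN iffD1])
  qed
  have dy: "5 * d a = 625 * y + a"
  proof -
    have "625 * y^5 * (z - 1) * (5 * d a) = 625 * y^5 * (z - 1) * (625 * y + a)"
      using e1 c unfolding t3 t1 t4 mult y1[symmetric] by algebra
    then show ?thesis by (rule mult_left_cancel[OF nz, THEN iffD1])
  qed
  have b: "b = 15625*(z-1)*y2 + 9375*(z-1)*y1 + (1250*z-4375)*y"
    using db unfolding c by (simp add: d_rules algebra_simps)
  have a: "a = 78125*(z-1)*y3 + (93750*z-15625)*y2 + (34375*z-3125)*y1 + (3750*z-625)*y"
    using da unfolding b by (simp add: d_rules algebra_simps)
  have "625 * (625 * (1 - z) * y4) = 625 * (z * (1250 * y3 + 875 * y2 + 250 * y1 + 24 * y))"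
    using dy unfolding a by (simp add: d_rules algebra_simps)
  then show "625 * (1 - z) * y4 = z * (1250 * y3 + 875 * y2 + 250 * y1 + 24 * y)"
    by simp
  show "t3 = 3125 * y^3 * (z - 1) * y1 + 625 * y^4 * (z - 6)"
    unfolding t3 c by algebra
qed

text \<open>Since \<open>t6\<close> is a multiple of \<open>d t5\<close>, the equation
  \<open>e6\<close> is of second order in \<open>t5\<close>. Expressing \<open>t5\<close> by
  \<open>w\<close> and \<open>t3\<close> by \<open>y\<close> and \<open>y1\<close> makes the terms
  in \<open>y1^2\<close> cancel.\<close>

lemma wronskian_equation_from_system:
  fixes d :: "'a::{idom,semiring_char_0} \<Rightarrow> 'a"
  assumes der: "derivation d" and y: "y \<noteq> 0" and z1: "z \<noteq> 1"
    and t4: "t4 = y^5 * z"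
    and dz: "d z = z"
    and y1: "y1 = d y" and y2: "y2 = d y1" and w1: "w1 = d w" and w2: "w2 = d w1"
    and t3: "t3 = 3125 * y^3 * (z - 1) * y1 + 625 * y^4 * (z - 6)"
    and t5: "5 * t5 = y^2 * (z - 1) * w"
    and t6: "t6 = y^4 * (z - 1) * d t5"
    and e6: "1953125 * y^4 * (z - 1) * d t6 = t5 * (- 28125000 * y^8 - 15000 * y^4 * t3
                - 1171875 * y^3 * t4 - 2 * t3^2) + t6 * (23437500 * y^4 + 6250 * t3)"
  shows "5 * (1 - z) * (y * w2 - 2 * (y1 * w1 - y2 * w)) = z * y * (5 * w1 + 2 * w)"
proof -
  interpret derivation d by fact
  note d_rules = add diff minus mult power2 power3 power4 power5 dz y1[symmetric] y2[symmetric]  w1[symmetric] w2[symmetric]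
  \<comment> \<open>Differentiating \<open>y^2\<close> leaves one factor \<open>y\<close> in
    \<open>5 * d t5\<close>; \<open>s\<close> is its cofactor.\<close>
  define s where "s = 2 * y1 * (z - 1) * w + y * z * w + y * (z - 1) * w1"
  have dt5: "5 * d t5 = y * s"
    using arg_cong[OF t5, of d] unfolding s_def d_rules numeral one by algebra
  have t6: "5 * t6 = y^5 * (z - 1) * s"
    using dt5 t6 by algebra
  have ds: "d s = 2 * y2 * (z - 1) * w + 2 * y1 * z * w + 2 * y1 * (z - 1) * w1
     + y1 * z * w + y * z * w + y * z * w1
     + y1 * (z - 1) * w1 + y * z * w1 + y * (z - 1) * w2"
    unfolding s_def by (simp add: d_rules algebra_simps)
  have dt6: "5 * d t6 = 5 * y^4 * y1 * (z - 1) * s + y^5 * z * s + y^5 * (z - 1) * d s"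
    using arg_cong[OF t6, of d] unfolding d_rules numeral one by algebra
  have e6': "1953125 * y^4 * (z - 1) * (5 * d t6) = (5 * t5) * (- 28125000 * y^8 - 15000 * y^4 * t3
                - 1171875 * y^3 * t4 - 2 * t3^2) + (5 * t6) * (23437500 * y^4 + 6250 * t3)"
    using e6 by algebra
  have "390625 * y^9 * (z - 1)^2 * (5 * (1 - z) * (y * w2 - 2 * (y1 * w1 - y2 * w)))
     = 390625 * y^9 * (z - 1)^2 * (z * y * (5 * w1 + 2 * w))"
    using e6' unfolding dt6 ds t6 t5 t3 t4 unfolding s_def by algebra
  moreover have "390625 * y^9 * (z - 1)^2 \<noteq> 0"
    using y z1 by simp
  ultimately show ?thesis by (rule mult_left_cancel[THEN iffD1, rotated])
qed

text \<open>
  Here \<open>r\<close> is the symplectic pairing of the two solutions, up to the factor \<open>5 (1 - z)\<close>.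
  The functions \<open>g\<close>, \<open>g1\<close>, ... stand for the logarithm-free parts of a second solution and its
  derivatives, which is where the summands \<open>f\<close>, \<open>f1\<close>, ... come from.
\<close>

lemma hypergeometric_wronskian:
  fixes d :: "'a::{idom,semiring_char_0} \<Rightarrow> 'a"
  assumes der: "derivation d" and dz: "d z = z"
    and f: "f1 = d f" "f2 = d f1" "f3 = d f2" "f4 = d f3"
    and g: "g1 = d g + f" "g2 = d g1 + f1" "g3 = d g2 + f2" "g4 = d g3 + f3"
    and pf: "625 * (1 - z) * f4 = z * (1250 * f3 + 875 * f2 + 250 * f1 + 24 * f)"
    and pg: "625 * (1 - z) * g4 = z * (1250 * g3 + 875 * g2 + 250 * g1 + 24 * g)"
    and w: "w = f * g1 - f1 * g" "w1 = d w" "w2 = d w1"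
    and r: "r = 5 * (1 - z) * (f * g3 - f3 * g - (f1 * g2 - f2 * g1)) - 5 * z * w1 - 2 * z * w"
  shows "d r = 0"
    and "r = 0 \<Longrightarrow> 5 * (1 - z) * (f * w2 - 2 * (f1 * w1 - f2 * w)) = z * f * (5 * w1 + 2 * w)"
proof -
  interpret derivation d by fact
  have df: "d f = f1" "d f1 = f2" "d f2 = f3" "d f3 = f4" using f by simp_all
  have dg: "d g = g1 - f" "d g1 = g2 - f1" "d g2 = g3 - f2" "d g3 = g4 - f3" using g by simp_all
  have w1: "w1 = f * g2 - f2 * g"
    unfolding w diff mult df dg by algebra
  have w2: "w2 = f * g3 - f3 * g + (f1 * g2 - f2 * g1)"
    unfolding w(3) w1 diff mult df dg by algebra
  have "d r = 5 * (1 - z) * (f * g4 - f4 * g) - 5 * z * (f * g3 - f3 * g - (f1 * g2 - f2 * g1))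
     - 5 * z * (w1 + w2) - 2 * z * (w + w1)"
    unfolding r diff mult numeral one dz df dg w(2)[symmetric] w(3)[symmetric] by algebra
  \<comment> \<open>The factor 125 produces the leading coefficient \<open>625 * (1 - z)\<close> of
    \<open>pf\<close> and \<open>pg\<close>. The terms with 24 cancel by antisymmetry, and those
    with 1250, 875 and 250 match the remaining summands.\<close>
  moreover have "125 * (5 * (1 - z) * (f * g4 - f4 * g) - 5 * z * (f * g3 - f3 * g - (f1 * g2 - f2 * g1))
     - 5 * z * (w1 + w2) - 2 * z * (w + w1)) = 0"
    using pf pg unfolding w1 w2 unfolding w(1) by algebra
  ultimately have "125 * d r = 0" by simp
  then show "d r = 0" by simp
  \<comment> \<open>Multiply \<open>r = 0\<close> by \<open>f\<close> and use the Pluecker relation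
    \<open>f * (f1 * g2 - f2 * g1) = f1 * w1 - f2 * w\<close>.\<close>
  show "5 * (1 - z) * (f * w2 - 2 * (f1 * w1 - f2 * w)) = z * f * (5 * w1 + 2 * w)" if "r = 0"
    using that r unfolding w1 w2 unfolding w(1) by algebra
qed

section \<open>Recurrences for the hypergeometric coefficients\<close>

definition quintic_coeff :: "nat \<Rightarrow> complex" where
  "quintic_coeff n = fact (5 * n) / fact n ^ 5"

text \<open>With harmonic numbers this is \<open>H_(5n) - H_n\<close>. Five times it is the
  logarithmic derivative of \<open>(5n)! / n!^5\<close> in \<open>n\<close>, read through the Gamma
  function.\<close>

definition harmonic_gap :: "nat \<Rightarrow> complex" where
  "harmonic_gap n = (\<Sum>k = Suc n..5 * n. 1 / of_nat k)"

lemma quintic_coeff_Suc: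
  "(of_nat n + 1) ^ 4 * quintic_coeff (Suc n) =
     5 * (5 * of_nat n + 1) * (5 * of_nat n + 2) * (5 * of_nat n + 3) * (5 * of_nat n + 4) * quintic_coeff n"
proof -
  define x :: complex where "x = of_nat n"
  have x: "x + 1 \<noteq> 0"
    unfolding x_def by (metis of_nat_Suc of_nat_neq_0 add.commute)
  have "5 * Suc n = Suc (Suc (Suc (Suc (Suc (5 * n)))))" by simp
  then have "(fact (5 * Suc n) :: complex) =
      (5 * x + 5) * (5 * x + 4) * (5 * x + 3) * (5 * x + 2) * (5 * x + 1) * fact (5 * n)"
    by (simp only: fact_Suc) (simp add: x_def algebra_simps)
  moreover have "(fact (Suc n) :: complex) = (x + 1) * fact n"
    by (simp add: x_def)
  ultimately have "(x + 1) ^ 4 * quintic_coeff (Suc n) = (x + 1) ^ 4 *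
      ((5 * x + 5) * (5 * x + 4) * (5 * x + 3) * (5 * x + 2) * (5 * x + 1) * fact (5 * n) / ((x + 1) ^ 5 * fact n ^ 5))"
    by (simp only: quintic_coeff_def power_mult_distrib)
  also have "\<dots> = (5 * x + 5) / (x + 1) * ((x + 1) ^ 5 / (x + 1) ^ 5) *
      ((5 * x + 4) * (5 * x + 3) * (5 * x + 2) * (5 * x + 1) * (fact (5 * n) / fact n ^ 5))"
    using x by (simp add: divide_simps) (simp add: eval_nat_numeral)
  also have "\<dots> = 5 * (5 * x + 1) * (5 * x + 2) * (5 * x + 3) * (5 * x + 4) * quintic_coeff n"
  proof -
    have "(5 * x + 5) / (x + 1) = 5" using x by (simp add: divide_simps)
    then show ?thesis using x by (simp add: quintic_coeff_def mult_ac)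
  qed
  finally show ?thesis by (simp add: x_def)
qed

lemma harmonic_gap_Suc:
  "harmonic_gap (Suc n) = harmonic_gap n + 1 / (5 * of_nat n + 1) + 1 / (5 * of_nat n + 2)
     + 1 / (5 * of_nat n + 3) + 1 / (5 * of_nat n + 4) - 4 / (5 * (of_nat n + 1))"
proof -
  have gap: "harmonic_gap m = (\<Sum>k=1..5 * m. 1 / of_nat k) - (\<Sum>k=1..m. 1 / of_nat k)" for m
  proof -
    have "{1..5 * m} = {1..m} \<union> {Suc m..5 * m}" "{1..m} \<inter> {Suc m..5 * m} = {}" by auto
    then have "(\<Sum>k=1..5 * m. 1 / of_nat k :: complex) =
        (\<Sum>k=1..m. 1 / of_nat k) + (\<Sum>k=Suc m..5 * m. 1 / of_nat k)"
      by (simp add: sum.union_disjoint)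
    then show ?thesis by (simp add: harmonic_gap_def)
  qed
  have e: "5 * Suc n = Suc (Suc (Suc (Suc (Suc (5 * n)))))" by simp
  have "harmonic_gap (Suc n) = harmonic_gap n + 1 / of_nat (Suc (5 * n)) + 1 / of_nat (Suc (Suc (5 * n)))
      + 1 / of_nat (Suc (Suc (Suc (5 * n)))) + 1 / of_nat (Suc (Suc (Suc (Suc (5 * n)))))
      + 1 / of_nat (5 * Suc n) - 1 / of_nat (Suc n)"
    unfolding gap e by (simp del: of_nat_Suc)
  moreover have "1 / of_nat (5 * Suc n) - 1 / of_nat (Suc n) = - (4 / (5 * (of_nat n + 1)) :: complex)"
  proof -
    have "of_nat (5 * Suc n) = (5 * of_nat (Suc n) :: complex)" by (simp only: of_nat_mult) simp
    then show ?thesis by (simp add: field_simps del: of_nat_Suc)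
  qed
  ultimately show ?thesis by (simp add: add.commute)
qed

text \<open>Frobenius method: this is the derivative in \<open>x\<close> of the recurrence
  \<open>(x + 1)^4 a(x + 1) = p(x) a(x)\<close>, where \<open>b\<close> plays the role of
  \<open>a'\<close> and the cubic is \<open>p'\<close>.\<close>

lemma quintic_log_coeff_Suc:
  fixes n :: nat
  defines "x \<equiv> of_nat n :: complex"
  defines "b \<equiv> \<lambda>n. 5 * (quintic_coeff n * harmonic_gap n)"
  shows "(x + 1) ^ 4 * b (Suc n) + 4 * (x + 1) ^ 3 * quintic_coeff (Suc n) =
     5 * (5 * x + 1) * (5 * x + 2) * (5 * x + 3) * (5 * x + 4) * b n
     + (12500 * x ^ 3 + 18750 * x ^ 2 + 8750 * x + 1250) * quintic_coeff n"
proof -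
  have nz: "x + 1 \<noteq> 0" "5 * x + 1 \<noteq> 0" "5 * x + 2 \<noteq> 0" "5 * x + 3 \<noteq> 0" "5 * x + 4 \<noteq> 0"
  proof -
    have "of_nat (Suc n) \<noteq> (0::complex)" "of_nat (5 * n + 1) \<noteq> (0::complex)" "of_nat (5 * n + 2) \<noteq> (0::complex)"
      "of_nat (5 * n + 3) \<noteq> (0::complex)" "of_nat (5 * n + 4) \<noteq> (0::complex)"
      by (simp_all only: of_nat_eq_0_iff)
    then show "x + 1 \<noteq> 0" "5 * x + 1 \<noteq> 0" "5 * x + 2 \<noteq> 0" "5 * x + 3 \<noteq> 0" "5 * x + 4 \<noteq> 0"
      by (simp_all add: x_def add.commute)
  qed
  define p where "p = 5 * (5 * x + 1) * (5 * x + 2) * (5 * x + 3) * (5 * x + 4)"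
  \<comment> \<open>Naming the reciprocals turns the claim into a polynomial identity modulo the
    relations \<open>ii\<close>.\<close>
  define i0 i1 i2 i3 i4 where i: "i0 = 1 / (x + 1)" "i1 = 1 / (5 * x + 1)" "i2 = 1 / (5 * x + 2)"
    "i3 = 1 / (5 * x + 3)" "i4 = 1 / (5 * x + 4)"
  have ii: "i0 * (x + 1) = 1" "i1 * (5 * x + 1) = 1" "i2 * (5 * x + 2) = 1" "i3 * (5 * x + 3) = 1" "i4 * (5 * x + 4) = 1"
    using nz by (simp_all add: i)
  have a: "(x + 1) ^ 4 * quintic_coeff (Suc n) = p * quintic_coeff n"
    unfolding x_def p_def by (rule quintic_coeff_Suc)
  have "4 / (5 * (x + 1)) = 4 / 5 * i0"
    by (simp add: i)
  then have "harmonic_gap (Suc n) = harmonic_gap n + i1 + i2 + i3 + i4 - 4 / 5 * i0"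
    using harmonic_gap_Suc[of n] unfolding i(2-5) x_def[symmetric] by (simp only:)
  then have h: "5 * harmonic_gap (Suc n) = 5 * (harmonic_gap n + i1 + i2 + i3 + i4) - 4 * i0"
    by simp
  \<comment> \<open>This is \<open>p'\<close>, as \<open>p\<close> times its logarithmic
    derivative.\<close>
  have dp: "5 * p * (i1 + i2 + i3 + i4) = 12500 * x ^ 3 + 18750 * x ^ 2 + 8750 * x + 1250"
    unfolding p_def using ii by algebra
  have "4 * (x + 1) ^ 3 * quintic_coeff (Suc n) = 4 * i0 * (p * quintic_coeff n)"
    unfolding a[symmetric] using ii by algebra
  then show ?thesis
    unfolding b_def p_def[symmetric] using a h dp by algebra
qed

section \<open>The Euler operator and uniqueness of power series solutions\<close>

lemma fps_XD_nth: "fps_nth (fps_XD f) n = of_nat n * fps_nth f n"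
  by (simp add: fps_XD_def fps_mult_fps_X_deriv_shift)

lemma derivation_XD: "derivation (\<lambda>f. E * fps_XD (f :: 'a::comm_ring_1 fps))"
  by unfold_locales (simp_all add: fps_XD_def algebra_simps)

lemma fps_compose_numeral [simp]: "numeral n oo (f :: 'a::comm_ring_1 fps) = numeral n"
  by (simp add: fps_numeral_fps_const)

text \<open>By the chain rule, a series \<open>v\<close> with \<open>\<theta> v = v\<close> serves
  as a coordinate: composition with it carries \<open>X d/dX\<close> to
  \<open>\<theta> = E * fps_XD\<close>.\<close>

lemma XD_compose:
  fixes f v :: "'a::idom fps"
  assumes "fps_nth v 0 = 0" and "E * fps_XD v = v"
  shows "E * fps_XD (f oo v) = fps_XD f oo v"
proof -
  have "E * fps_XD (f oo v) = (fps_deriv f oo v) * (E * fps_XD v)"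
    using assms(1) by (simp add: fps_XD_def fps_compose_deriv mult_ac)
  also have "\<dots> = fps_XD f oo v"
    using assms by (simp add: fps_XD_def fps_compose_mult_distrib mult_ac)
  finally show ?thesis .
qed

text \<open>Since \<open>E\<close> starts with 1, \<open>\<theta>\<close> multiplies the coefficient
  of order \<open>n\<close> by \<open>n\<close>. Iterated, this yields the indicial
  equation.\<close>

lemma XD_factor:
  fixes E r :: "'a::comm_ring_1 fps"
  assumes "f = fps_X ^ n * r" and "fps_nth E 0 = 1"
  obtains r' where "E * fps_XD f = fps_X ^ n * r'" "fps_nth r' 0 = of_nat n * fps_nth r 0"
proof
  have "fps_XD (fps_X ^ n :: 'a fps) = of_nat n * fps_X ^ n"
    by (induction n) (simp_all add: fps_XD_def algebra_simps)
  moreover have "fps_XD f = fps_XD (fps_X ^ n) * r + fps_X ^ n * fps_XD r"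
    unfolding assms(1) by (simp add: fps_XD_def algebra_simps)
  ultimately show "E * fps_XD f = fps_X ^ n * (E * (of_nat n * r + fps_XD r))"
    by (simp add: algebra_simps)
  show "fps_nth (E * (of_nat n * r + fps_XD r)) 0 = of_nat n * fps_nth r 0"
    using assms(2) by (simp add: fps_XD_nth)
qed

text \<open>All four exponents at \<open>z = 0\<close> vanish: in lowest order \<open>n > 0\<close>
  the left side contributes \<open>625 n^4\<close> times a nonzero coefficient, and the right side
  nothing because \<open>z\<close> has no constant term.\<close>

lemma picard_fuchs_unique:
  fixes E z y :: "'a::field_char_0 fps"
  assumes "fps_nth E 0 = 1" and "fps_nth z 0 = 0" and "fps_nth y 0 = 0"
    and "y1 = E * fps_XD y" and "y2 = E * fps_XD y1" and "y3 = E * fps_XD y2" and "y4 = E * fps_XD y3"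
    and "625 * (1 - z) * y4 = z * (1250 * y3 + 875 * y2 + 250 * y1 + 24 * y)"
  shows "y = 0"
proof (rule ccontr)
  assume "y \<noteq> 0"
  define n where "n = subdegree y"
  define r where "r = fps_shift n y"
  have r: "y = fps_X ^ n * r" "fps_nth r 0 \<noteq> 0"
    using \<open>y \<noteq> 0\<close> subdegree_decompose[of y] by (simp_all add: n_def r_def mult.commute)
  have n: "n > 0"
    unfolding n_def using assms(3) \<open>y \<noteq> 0\<close> by (simp add: subdegree_eq_0_iff zero_less_iff_neq_zero)
  obtain r1 where r1: "y1 = fps_X ^ n * r1" "fps_nth r1 0 = of_nat n * fps_nth r 0"
    using XD_factor[OF r(1) assms(1)] assms(4) by metis
  obtain r2 where r2: "y2 = fps_X ^ n * r2" "fps_nth r2 0 = of_nat n * fps_nth r1 0"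
    using XD_factor[OF r1(1) assms(1)] assms(5) by metis
  obtain r3 where r3: "y3 = fps_X ^ n * r3" "fps_nth r3 0 = of_nat n * fps_nth r2 0"
    using XD_factor[OF r2(1) assms(1)] assms(6) by metis
  obtain r4 where r4: "y4 = fps_X ^ n * r4" "fps_nth r4 0 = of_nat n * fps_nth r3 0"
    using XD_factor[OF r3(1) assms(1)] assms(7) by metis
  have "fps_X ^ n * (625 * (1 - z) * r4) = fps_X ^ n * (z * (1250 * r3 + 875 * r2 + 250 * r1 + 24 * r))"
    using assms(8) unfolding r(1) r1(1) r2(1) r3(1) r4(1) by (simp add: algebra_simps)
  then have "625 * (1 - z) * r4 = z * (1250 * r3 + 875 * r2 + 250 * r1 + 24 * r)"
    by simp
  from arg_cong[OF this, of "\<lambda>f. fps_nth f 0"] show False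
    using r r1 r2 r3 r4 n assms(2) by simp
qed

text \<open>The same lowest order argument: \<open>z\<close>, \<open>y1\<close> and
  \<open>y2\<close> have no constant term, so only \<open>5 n^2\<close> times two nonzero
  coefficients remains.\<close>

lemma wronskian_unique:
  fixes E z y w :: "'a::field_char_0 fps"
  assumes "fps_nth E 0 = 1" and "fps_nth z 0 = 0" and "fps_nth y 0 \<noteq> 0" and "fps_nth w 0 = 0"
    and "y1 = E * fps_XD y" and "y2 = E * fps_XD y1"
    and "w1 = E * fps_XD w" and "w2 = E * fps_XD w1"
    and "5 * (1 - z) * (y * w2 - 2 * (y1 * w1 - y2 * w)) = z * y * (5 * w1 + 2 * w)"
  shows "w = 0"
proof (rule ccontr)
  assume "w \<noteq> 0"
  define n where "n = subdegree w"
  define r where "r = fps_shift n w"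
  have r: "w = fps_X ^ n * r" "fps_nth r 0 \<noteq> 0"
    using \<open>w \<noteq> 0\<close> subdegree_decompose[of w] by (simp_all add: n_def r_def mult.commute)
  have n: "n > 0"
    unfolding n_def using assms(4) \<open>w \<noteq> 0\<close> by (simp add: subdegree_eq_0_iff zero_less_iff_neq_zero)
  obtain r1 where r1: "w1 = fps_X ^ n * r1" "fps_nth r1 0 = of_nat n * fps_nth r 0"
    using XD_factor[OF r(1) assms(1)] assms(7) by metis
  obtain r2 where r2: "w2 = fps_X ^ n * r2" "fps_nth r2 0 = of_nat n * fps_nth r1 0"
    using XD_factor[OF r1(1) assms(1)] assms(8) by metis
  have y0: "fps_nth y1 0 = 0" "fps_nth y2 0 = 0"
    by (simp_all add: assms(5,6) fps_XD_nth)
  have "fps_X ^ n * (5 * (1 - z) * (y * r2 - 2 * (y1 * r1 - y2 * r))) = fps_X ^ n * (z * y * (5 * r1 + 2 * r))"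
    using assms(9) unfolding r(1) r1(1) r2(1) by (simp add: algebra_simps)
  then have "5 * (1 - z) * (y * r2 - 2 * (y1 * r1 - y2 * r)) = z * y * (5 * r1 + 2 * r)"
    by simp
  from arg_cong[OF this, of "\<lambda>f. fps_nth f 0"] show False
    using r r1 r2 n assms(2,3) y0 by simp
qed

section \<open>The hypergeometric series and their Wronskian\<close>

definition hyp_fps :: "complex fps" where
  "hyp_fps = Abs_fps quintic_coeff"

text \<open>The logarithm-free part of \<open>hyp1\<close>.\<close>

definition log_fps :: "complex fps" where
  "log_fps = Abs_fps (\<lambda>n. 5 * (quintic_coeff n * harmonic_gap n))"

lemma hyp_fps_0 [simp]: "fps_nth hyp_fps 0 = 1"
  by (simp add: hyp_fps_def quintic_coeff_def)

lemma log_fps_0 [simp]: "fps_nth log_fps 0 = 0"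
  by (simp add: log_fps_def harmonic_gap_def)

text \<open>In degree \<open>n + 1\<close> this is 625 times the recurrence
  \<open>quintic_coeff_Suc\<close>, with the \<open>n^4\<close> term of its right side moved to the
  left.\<close>

lemma hyp_fps_picard_fuchs:
  defines "f1 \<equiv> fps_XD hyp_fps"
  defines "f2 \<equiv> fps_XD f1"
  defines "f3 \<equiv> fps_XD f2"
  defines "f4 \<equiv> fps_XD f3"
  shows "625 * (1 - 3125 * fps_X) * f4 = 3125 * fps_X * (1250 * f3 + 875 * f2 + 250 * f1 + 24 * hyp_fps)"
proof (rule fps_ext)
  fix m
  show "fps_nth (625 * (1 - 3125 * fps_X) * f4) m =
    fps_nth (3125 * fps_X * (1250 * f3 + 875 * f2 + 250 * f1 + 24 * hyp_fps)) m"
  proof (cases m)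
    case 0
    then show ?thesis by (simp add: f4_def fps_XD_nth)
  next
    case (Suc n)
    have "fps_nth (625 * (1 - 3125 * fps_X) * f4) m = 625 * (fps_nth f4 (Suc n) - 3125 * fps_nth f4 n)"
    proof -
      have "625 * (1 - 3125 * fps_X) * f4 = 625 * (f4 - 3125 * (fps_X * f4))"
        by (simp only: left_diff_distrib right_diff_distrib mult.assoc mult_1)
      then show ?thesis by (simp add: Suc)
    qed
    moreover have "fps_nth (3125 * fps_X * (1250 * f3 + 875 * f2 + 250 * f1 + 24 * hyp_fps)) m =
      3125 * (1250 * fps_nth f3 n + 875 * fps_nth f2 n + 250 * fps_nth f1 n + 24 * fps_nth hyp_fps n)"
      by (simp add: Suc mult.assoc)
    ultimately show ?thesis
      using quintic_coeff_Suc[of n]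
      unfolding f4_def f3_def f2_def f1_def fps_XD_nth hyp_fps_def fps_nth_Abs_fps of_nat_Suc
      by algebra
  qed
qed

text \<open>Each \<open>gk\<close> has coefficients \<open>n^k b(n) + k n^(k-1) a(n)\<close>, so the
  degree \<open>n + 1\<close> part combines both recurrences.\<close>

lemma log_fps_picard_fuchs:
  defines "g1 \<equiv> fps_XD log_fps + hyp_fps"
  defines "g2 \<equiv> fps_XD g1 + fps_XD hyp_fps"
  defines "g3 \<equiv> fps_XD g2 + fps_XD (fps_XD hyp_fps)"
  defines "g4 \<equiv> fps_XD g3 + fps_XD (fps_XD (fps_XD hyp_fps))"
  shows "625 * (1 - 3125 * fps_X) * g4 = 3125 * fps_X * (1250 * g3 + 875 * g2 + 250 * g1 + 24 * log_fps)"
proof (rule fps_ext)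
  fix m
  show "fps_nth (625 * (1 - 3125 * fps_X) * g4) m =
    fps_nth (3125 * fps_X * (1250 * g3 + 875 * g2 + 250 * g1 + 24 * log_fps)) m"
  proof (cases m)
    case 0
    then show ?thesis by (simp add: g4_def fps_XD_nth)
  next
    case (Suc n)
    have "fps_nth (625 * (1 - 3125 * fps_X) * g4) m = 625 * (fps_nth g4 (Suc n) - 3125 * fps_nth g4 n)"
    proof -
      have "625 * (1 - 3125 * fps_X) * g4 = 625 * (g4 - 3125 * (fps_X * g4))"
        by (simp only: left_diff_distrib right_diff_distrib mult.assoc mult_1)
      then show ?thesis by (simp add: Suc)
    qed
    moreover have "fps_nth (3125 * fps_X * (1250 * g3 + 875 * g2 + 250 * g1 + 24 * log_fps)) m =
      3125 * (1250 * fps_nth g3 n + 875 * fps_nth g2 n + 250 * fps_nth g1 n + 24 * fps_nth log_fps n)"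
      by (simp add: Suc mult.assoc)
    ultimately show ?thesis
      using quintic_coeff_Suc[of n] quintic_log_coeff_Suc[of n]
      unfolding g4_def g3_def g2_def g1_def fps_add_nth fps_XD_nth hyp_fps_def log_fps_def fps_nth_Abs_fps of_nat_Suc
      by algebra
  qed
qed

text \<open>The logarithms in \<open>h0 \<theta> h1 - h1 \<theta> h0\<close> cancel; the summand
  \<open>hyp_fps\<close> in the parentheses comes from \<open>\<theta> log u = 1\<close>.\<close>

definition wronskian_fps :: "complex fps" where
  "wronskian_fps = hyp_fps * (fps_XD log_fps + hyp_fps) - fps_XD hyp_fps * log_fps"

lemma wronskian_fps_0: "fps_nth wronskian_fps 0 = 1"
  by (simp add: wronskian_fps_def fps_XD_nth)

lemma wronskian_fps_equation:
  defines "z \<equiv> 3125 * fps_X"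
  defines "f1 \<equiv> fps_XD hyp_fps"
  defines "f2 \<equiv> fps_XD f1"
  defines "w1 \<equiv> fps_XD wronskian_fps"
  defines "w2 \<equiv> fps_XD w1"
  shows "5 * (1 - z) * (hyp_fps * w2 - 2 * (f1 * w1 - f2 * wronskian_fps)) =
    z * hyp_fps * (5 * w1 + 2 * wronskian_fps)"
proof -
  define f3 where "f3 = fps_XD f2"
  define g1 where "g1 = fps_XD log_fps + hyp_fps"
  define g2 where "g2 = fps_XD g1 + f1"
  define g3 where "g3 = fps_XD g2 + f2"
  define r where "r = 5 * (1 - z) * (hyp_fps * g3 - f3 * log_fps - (f1 * g2 - f2 * g1))
    - 5 * z * w1 - 2 * z * wronskian_fps"
  have der: "derivation (fps_XD :: complex fps \<Rightarrow> complex fps)"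
    using derivation_XD[of 1] by simp
  have dz: "fps_XD z = z"
    by (simp add: z_def fps_XD_def)
  have pf: "625 * (1 - z) * fps_XD f3 = z * (1250 * f3 + 875 * f2 + 250 * f1 + 24 * hyp_fps)"
    unfolding z_def f3_def f2_def f1_def by (rule hyp_fps_picard_fuchs)
  have pg: "625 * (1 - z) * (fps_XD g3 + f3) = z * (1250 * g3 + 875 * g2 + 250 * g1 + 24 * log_fps)"
    unfolding z_def g3_def g2_def g1_def f3_def f2_def f1_def by (rule log_fps_picard_fuchs)
  have w: "wronskian_fps = hyp_fps * g1 - f1 * log_fps"
    by (simp add: wronskian_fps_def g1_def f1_def)
  note eq = hypergeometric_wronskian[where d = fps_XD,
     OF der dz meta_eq_to_obj_eq[OF f1_def] meta_eq_to_obj_eq[OF f2_def] f3_def refl[of "fps_XD f3"]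
     g1_def g2_def g3_def refl[of "fps_XD g3 + f3"] pf pg w meta_eq_to_obj_eq[OF w1_def] meta_eq_to_obj_eq[OF w2_def] r_def]
  \<comment> \<open>The Lagrangian condition: \<open>fps_XD r = 0\<close> leaves only the constant
    term of \<open>r\<close>, which vanishes because \<open>z\<close>, \<open>f1\<close>,
    \<open>f2\<close>, \<open>f3\<close> and \<open>g3\<close> have none.\<close>
  have "r = 0"
  proof (rule fps_ext)
    fix n
    have "of_nat n * fps_nth r n = 0"
      using eq(1) fps_XD_nth[of r n] by simp
    moreover have "fps_nth r 0 = 0"
      by (simp add: r_def z_def g3_def g2_def f3_def f2_def f1_def fps_XD_nth)
    ultimately show "fps_nth r n = fps_nth 0 n" by (cases "n = 0") auto
  qed
  then show ?thesis by (rule eq(2))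
qed

section \<open>Clearing denominators in the differential system\<close>

lemma quintic_system_cleared:
  assumes sys: "quintic_system t0 t1 t2 t3 t4 t5 t6" and t5: "fps_nth t5 0 \<noteq> 0"
  shows "3125 * (t5 * qdot t0) = 3750 * t0^5 + t0 * t3 - 625 * t4"
    and "3125 * (t5 * qdot t1) = - 390625 * t0^6 + 3125 * t0^4 * t1 + 390625 * t0 * t4 + t1 * t3"
    and "3125 * (t5 * qdot t2) = - 5859375 * t0^7 - 625 * t0^5 * t1 + 6250 * t0^4 * t2
                + 5859375 * t0^2 * t4 + 625 * t1 * t4 + 2 * t2 * t3"
    and "3125 * (t5 * qdot t3) = - 9765625 * t0^8 - 625 * t0^5 * t2 + 9375 * t0^4 * t3
                + 9765625 * t0^3 * t4 + 625 * t2 * t4 + 3 * t3^2"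
    and "625 * (t5 * qdot t4) = 3125 * t0^4 * t4 + t3 * t4"
    and "t5 * qdot t5 = t6"
    and "1953125 * (t5 * qdot t6) = t5 * (- 28125000 * t0^8 - 15000 * t0^4 * t3
                - 1171875 * t0^3 * t4 - 2 * t3^2) + t6 * (23437500 * t0^4 + 6250 * t3)"
proof -
  have cancel: "t5 * (f / t5) = f" for f
    using t5 inverse_mult_eq_1[OF t5] by (simp add: fps_divide_unit mult_ac)
  \<comment> \<open>These relations are all that is used about the rational constants when the
    equations are scaled to integer coefficients.\<close>
  have c: "3125 * fps_const (1/3125 :: complex) = 1" "5 * fps_const (6/5 :: complex) = 6"
    "5 * fps_const (1/5 :: complex) = 1" "3125 * fps_const (2/3125 :: complex) = 2"
    "3125 * fps_const (3/3125 :: complex) = 3" "625 * fps_const (1/625 :: complex) = 1"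
    "5 * fps_const (- 72/5 :: complex) = - 72" "3125 * fps_const (24/3125 :: complex) = 24"
    "5 * fps_const (3/5 :: complex) = 3" "1953125 * fps_const (2/1953125 :: complex) = 2"
    "625 * fps_const (2/625 :: complex) = 2"
    by (simp_all add: fps_numeral_fps_const)
  note s = sys[unfolded quintic_system_def]
  have e: "t5 * qdot t0 = fps_const (6/5) * t0^5 + fps_const (1/3125) * t0 * t3 - fps_const (1/5) * t4"
    "t5 * qdot t1 = - 125 * t0^6 + t0^4 * t1 + 125 * t0 * t4 + fps_const (1/3125) * t1 * t3"
    "t5 * qdot t2 = - 1875 * t0^7 - fps_const (1/5) * t0^5 * t1 + 2 * t0^4 * t2 + 1875 * t0^2 * t4
                + fps_const (1/5) * t1 * t4 + fps_const (2/3125) * t2 * t3"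
    "t5 * qdot t3 = - 3125 * t0^8 - fps_const (1/5) * t0^5 * t2 + 3 * t0^4 * t3 + 3125 * t0^3 * t4
                + fps_const (1/5) * t2 * t4 + fps_const (3/3125) * t3^2"
    "t5 * qdot t4 = 5 * t0^4 * t4 + fps_const (1/625) * t3 * t4"
    using s by (simp_all only: cancel)
  show e5: "t5 * qdot t5 = t6"
    using s by (simp only: cancel)
  have "t5 * qdot t6 = t5 * (fps_const (- 72/5) * t0^8 - fps_const (24/3125) * t0^4 * t3
                - fps_const (3/5) * t0^3 * t4 - fps_const (2/1953125) * t3^2)
               + t5 * (t6 / t5) * (12 * t0^4 + fps_const (2/625) * t3)"
    using s by (simp only: distrib_left mult.assoc)
  then have e6: "t5 * qdot t6 = t5 * (fps_const (- 72/5) * t0^8 - fps_const (24/3125) * t0^4 * t3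
                - fps_const (3/5) * t0^3 * t4 - fps_const (2/1953125) * t3^2)
               + t6 * (12 * t0^4 + fps_const (2/625) * t3)"
    by (simp only: cancel)
  show "3125 * (t5 * qdot t0) = 3750 * t0^5 + t0 * t3 - 625 * t4"
    unfolding e using c by algebra
  show "3125 * (t5 * qdot t1) = - 390625 * t0^6 + 3125 * t0^4 * t1 + 390625 * t0 * t4 + t1 * t3"
    unfolding e using c by algebra
  show "3125 * (t5 * qdot t2) = - 5859375 * t0^7 - 625 * t0^5 * t1 + 6250 * t0^4 * t2
                + 5859375 * t0^2 * t4 + 625 * t1 * t4 + 2 * t2 * t3"
    unfolding e using c by algebra
  show "3125 * (t5 * qdot t3) = - 9765625 * t0^8 - 625 * t0^5 * t2 + 9375 * t0^4 * t3
                + 9765625 * t0^3 * t4 + 625 * t2 * t4 + 3 * t3^2"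
    unfolding e using c by algebra
  show "625 * (t5 * qdot t4) = 3125 * t0^4 * t4 + t3 * t4"
    unfolding e using c by algebra
  show "1953125 * (t5 * qdot t6) = t5 * (- 28125000 * t0^8 - 15000 * t0^4 * t3
                - 1171875 * t0^3 * t4 - 2 * t3^2) + t6 * (23437500 * t0^4 + 6250 * t3)"
    unfolding e6 using c by algebra
qed

section \<open>The mirror map as a power series\<close>

text \<open>This is \<open>h1 / h0 - log u\<close>.\<close>

definition ratio_fps :: "complex fps" where
  "ratio_fps = log_fps * inverse hyp_fps"

text \<open>The series of \<open>q = exp (h1 / h0)\<close> in \<open>u = z / 5^5\<close>.\<close>

definition mirror_fps :: "complex fps" where
  "mirror_fps = fps_X * (fps_exp 1 oo ratio_fps)"

text \<open>The second form of the coupling in the variable \<open>u\<close>, since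
  \<open>(u / q) dq/du = 1 + \<theta> (h1 / h0 - log u)\<close>.\<close>

definition yukawa_fps :: "complex fps" where
  "yukawa_fps = 5 * inverse ((1 - 3125 * fps_X) * hyp_fps ^ 2 * (1 + fps_XD ratio_fps) ^ 3)"

lemma ratio_fps_0 [simp]: "fps_nth ratio_fps 0 = 0"
  by (simp add: ratio_fps_def)

text \<open>The quotient rule for \<open>h1 / h0\<close>, multiplied by \<open>h0^2\<close>.\<close>

lemma hyp_ratio_wronskian: "hyp_fps ^ 2 * (1 + fps_XD ratio_fps) = wronskian_fps"
proof -
  interpret derivation "fps_XD :: complex fps \<Rightarrow> complex fps"
    using derivation_XD[of 1] by simp
  have r: "hyp_fps * ratio_fps = log_fps"
    using inverse_mult_eq_1[of hyp_fps] by (simp add: ratio_fps_def mult_ac)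
  then have "fps_XD log_fps = fps_XD hyp_fps * ratio_fps + hyp_fps * fps_XD ratio_fps"
    using mult by metis
  then show ?thesis
    using r[symmetric] unfolding wronskian_fps_def by algebra
qed

lemma XD_mirror_fps: "fps_XD mirror_fps = mirror_fps * (1 + fps_XD ratio_fps)"
  by (simp add: mirror_fps_def fps_XD_def fps_compose_deriv algebra_simps)

lemma XD_eq_self:
  fixes f :: "'a::field_char_0 fps"
  assumes "fps_XD f = f"
  shows "f = fps_const (fps_nth f 1) * fps_X"
proof (rule fps_ext)
  fix n
  have "of_nat n * fps_nth f n = fps_nth f n"
    using fps_XD_nth[of f n] assms by simp
  then show "fps_nth f n = fps_nth (fps_const (fps_nth f 1) * fps_X) n"
    by (auto simp: fps_X_def)
qed

lemma XD_nth_1: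
  "fps_nth (E * fps_XD f) 1 = fps_nth E 0 * fps_nth (f :: 'a::comm_ring_1 fps) 1"
  by (simp add: fps_mult_nth_1 fps_XD_nth)

text \<open>Here \<open>v\<close> is \<open>z / 5^5\<close> as a series in the variable of the
  system. That it inverts \<open>mirror_fps\<close> identifies this variable with the mirror
  coordinate \<open>q\<close>.\<close>

lemma quintic_system_mirror_map:
  assumes sys: "quintic_system t0 t1 t2 t3 t4 t5 t6"
    and t00: "fps_nth t0 0 = 1/5" and t01: "fps_nth t0 1 = 24"
    and t40: "fps_nth t4 0 = 0" and t50: "fps_nth t5 0 \<noteq> 0"
  obtains v where "fps_nth v 0 = 0" and "mirror_fps oo v = fps_X"
    and "(- ((t4 - t0 ^ 5) ^ 2)) / (625 * t5 ^ 3) = yukawa_fps oo v"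
proof -
  define z where "z = t4 * inverse (t0 ^ 5)"
  \<comment> \<open>Chosen so that \<open>t0^4 * (z - 1) * d f = t5 * qdot f\<close>, which up to
    integer factors is the shape of the left sides in the elimination lemmas; the 5 comes from
    \<open>qdot\<close>.\<close>
  define D where "D = t0 ^ 4 * (z - 1) * inverse (5 * t5)"
  define E where "E = inverse D"
  define d where "d = (\<lambda>f. E * fps_XD f)"
  have "inverse (t0 ^ 5) * t0 ^ 5 = 1"
    by (intro inverse_mult_eq_1) (simp add: fps_nth_power_0 t00)
  then have t4: "t4 = t0 ^ 5 * z"
    by (simp add: z_def mult_ac)
  have z0: "fps_nth z 0 = 0"
    by (simp add: z_def t40)
  then have z1: "z \<noteq> 1" by auto
  have t0nz: "t0 \<noteq> 0" using t00 by auto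
  have D0: "fps_nth D 0 \<noteq> 0"
    using t50 by (simp add: D_def fps_nth_power_0 t00 z0)
  have DE: "D * E = 1"
    using inverse_mult_eq_1[OF D0] by (simp add: E_def mult.commute)
  have "inverse (5 * t5) * (5 * t5) = 1"
    using t50 by (intro inverse_mult_eq_1) simp
  then have t5D: "5 * t5 * D = t0 ^ 4 * (z - 1)"
    unfolding D_def by algebra
  then have qd: "t0 ^ 4 * (z - 1) * d f = t5 * qdot f" for f
    using DE unfolding d_def qdot_def fps_XD_def by (simp add: o_def) algebra
  interpret derivation d
    unfolding d_def by (rule derivation_XD)
  have der: "derivation d" ..
  have dvd: "\<exists>a. t = t0 ^ n * a" for t n
  proof -
    have "inverse (t0 ^ n) * t0 ^ n = 1"
      by (intro inverse_mult_eq_1) (simp add: fps_nth_power_0 t00)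
    then have "t = t0 ^ n * (inverse (t0 ^ n) * t)" by (metis mult.assoc mult.commute mult_1)
    then show ?thesis ..
  qed
  obtain a where a: "t1 = t0 * a" using dvd[of t1 1] by auto
  obtain b where b: "t2 = t0 ^ 2 * b" using dvd by blast
  obtain c where c: "t3 = t0 ^ 3 * c" using dvd by blast
  define y1 where "y1 = d t0"
  define y2 where "y2 = d y1"
  define y3 where "y3 = d y2"
  define y4 where "y4 = d y3"
  note e = quintic_system_cleared[OF sys t50, folded qd, folded mult.assoc]
  note pf = picard_fuchs_from_system[OF der t0nz z1 a b c t4 y1_def y2_def y3_def y4_def e(1-5)]
  have dz: "d z = z" by (rule pf(1))
  \<comment> \<open>The coefficients of \<open>q\<close> in \<open>\<theta> z = z\<close> and in the Picard-Fuchs equation fix \<open>E\<close> and \<open>z\<close> to first order.\<close>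
  define e0 where "e0 = fps_nth E 0"
  have e0nz: "e0 \<noteq> 0"
    using D0 by (simp add: e0_def E_def)
  have d1: "fps_nth (d f) 1 = e0 * fps_nth f 1" for f
    unfolding d_def e0_def by (rule XD_nth_1)
  have "fps_nth (625 * (1 - z) * y4) 1 = 625 * (e0 ^ 4 * 24)"
  proof -
    have "fps_nth y4 0 = 0" by (simp add: y4_def d_def fps_XD_nth)
    moreover have "fps_nth y4 1 = e0 ^ 4 * 24"
      unfolding y4_def y3_def y2_def y1_def d1 t01 by (simp add: eval_nat_numeral)
    ultimately show ?thesis
      using z0 by (simp add: fps_mult_nth_1 mult.assoc)
  qed
  \<comment> \<open>This 24 is the last coefficient of the Picard-Fuchs equation, multiplied by the
    initial value \<open>1/5\<close>; the 24 on the other side is the prescribed coefficient of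
    \<open>t0\<close>.\<close>
  moreover have "fps_nth (z * (1250 * y3 + 875 * y2 + 250 * y1 + 24 * t0)) 1 = fps_nth z 1 * (24 / 5)"
  proof -
    have "fps_nth y1 0 = 0" "fps_nth y2 0 = 0" "fps_nth y3 0 = 0"
      by (simp_all add: y1_def y2_def y3_def d_def fps_XD_nth)
    then show ?thesis
      by (simp add: z0 t00 fps_mult_nth_1)
  qed
  ultimately have "625 * (e0 ^ 4 * 24) = fps_nth z 1 * (24 / 5)"
    unfolding pf(2) by (simp only:)
  then have z_1: "fps_nth z 1 = 3125 * e0 ^ 4" by simp
  then have "fps_nth z 1 \<noteq> 0" using e0nz by simp
  with d1[of z] have "e0 = 1"
    unfolding dz by (metis mult_cancel_right1)
  then have E0: "fps_nth E 0 = 1" by (simp add: e0_def)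
  define v where "v = fps_const (1/3125) * z"
  have v0: "fps_nth v 0 = 0" by (simp add: v_def z0)
  have v1: "fps_nth v 1 = 1" using z_1 by (simp add: v_def \<open>e0 = 1\<close>)
  have z: "z = 3125 * v" by (simp add: v_def fps_numeral_fps_const flip: mult.assoc)
  have dv: "E * fps_XD v = v"
    using dz unfolding z d_def by (simp add: fps_XD_def algebra_simps)
  have comp: "d (f oo v) = fps_XD f oo v" for f
    unfolding d_def by (rule XD_compose[OF v0 dv])
  note compose = fps_compose_mult_distrib[OF v0] fps_compose_add_distrib fps_compose_sub_distrib
    fps_compose_power[OF v0] fps_X_fps_compose_startby0[OF v0] comp[symmetric]
  define h where "h = hyp_fps oo v"
  have h0: "fps_nth h 0 = 1" by (simp add: h_def)
  have pfh: "625 * (1 - z) * d (d (d (d h))) = z * (1250 * d (d (d h)) + 875 * d (d h) + 250 * d h + 24 * h)"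
    using arg_cong[OF hyp_fps_picard_fuchs, of "\<lambda>f. f oo v"] by (simp add: compose h_def z)
  have "5 * t0 - h = 0"
  proof (rule picard_fuchs_unique[OF E0 z0])
    show "fps_nth (5 * t0 - h) 0 = 0" by (simp add: t00 h0)
    have "625 * (1 - z) * (5 * y4 - d (d (d (d h)))) =
       z * (1250 * (5 * y3 - d (d (d h))) + 875 * (5 * y2 - d (d h)) + 250 * (5 * y1 - d h) + 24 * (5 * t0 - h))"
      using pf(2) pfh by algebra
    then show "625 * (1 - z) * d (d (d (d (5 * t0 - h)))) =
       z * (1250 * d (d (d (5 * t0 - h))) + 875 * d (d (5 * t0 - h)) + 250 * d (5 * t0 - h) + 24 * (5 * t0 - h))"
      by (simp add: diff y1_def y2_def y3_def y4_def)
  qed (rule fun_cong[OF d_def, of "_"])+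
  then have h: "h = 5 * t0" by simp
  define w where "w = t0 ^ 2 * E"
  define w' where "w' = wronskian_fps oo v"
  have t5: "5 * t5 = t0 ^ 2 * (z - 1) * w"
    using t5D DE unfolding w_def by algebra
  have t6: "t6 = t0 ^ 4 * (z - 1) * d t5"
    by (simp only: e(6))
  note ww = wronskian_equation_from_system[OF der t0nz z1 t4 dz y1_def y2_def refl refl pf(3) t5 t6 e(7)]
  have "5 * (1 - z) * (h * d (d w') - 2 * (d h * d w' - d (d h) * w')) = z * h * (5 * d w' + 2 * w')"
    using arg_cong[OF wronskian_fps_equation, of "\<lambda>f. f oo v"] by (simp add: compose h_def w'_def z)
  then have ww': "5 * (5 * (1 - z) * (t0 * d (d w') - 2 * (y1 * d w' - y2 * w'))) = 5 * (z * t0 * (5 * d w' + 2 * w'))"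
    unfolding h numeral_mult y1_def[symmetric] y2_def[symmetric] by algebra
  \<comment> \<open>The 25 comes from \<open>h = 5 * t0\<close>; it matches the constant terms
    \<open>1/25\<close> of \<open>w\<close> and \<open>1\<close> of \<open>w'\<close>.\<close>
  have "25 * w - w' = 0"
  proof (rule wronskian_unique[OF E0 z0])
    show "fps_nth t0 0 \<noteq> 0" by (simp add: t00)
    show "fps_nth (25 * w - w') 0 = 0"
      by (simp add: w_def w'_def wronskian_fps_0 E0 t00 fps_nth_power_0 power2_eq_square)
    have "5 * (1 - z) * (t0 * (25 * d (d w) - d (d w')) - 2 * (y1 * (25 * d w - d w') - y2 * (25 * w - w'))) =
       z * t0 * (5 * (25 * d w - d w') + 2 * (25 * w - w'))"
      using ww ww'[unfolded mult_cancel_left] by simp algebra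
    then show "5 * (1 - z) * (t0 * d (d (25 * w - w')) - 2 * (d t0 * d (25 * w - w') - d (d t0) * (25 * w - w'))) =
       z * t0 * (5 * d (25 * w - w') + 2 * (25 * w - w'))"
      by (simp add: diff y1_def y2_def)
  qed (rule fun_cong[OF d_def, of "_"])+
  then have w': "w' = h ^ 2 * E"
    unfolding h w_def by algebra
  define s where "s = (1 + fps_XD ratio_fps) oo v"
  have "h ^ 2 * s = w'"
    using arg_cong[OF hyp_ratio_wronskian, of "\<lambda>f. f oo v"]
    by (simp add: compose h_def s_def w'_def)
  moreover have "h \<noteq> 0" using h0 by auto
  ultimately have s: "s = E" using w' by simp
  define N where "N = mirror_fps oo v"
  \<comment> \<open>As \<open>s = E\<close>, cancelling \<open>E\<close> gives
    \<open>q dN/dq = N\<close>, so \<open>N\<close> is a multiple of \<open>q\<close>.\<close>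
  have "d N = N * s"
    unfolding N_def comp XD_mirror_fps s_def by (rule fps_compose_mult_distrib[OF v0])
  then have "D * E * fps_XD N = D * E * N"
    unfolding s d_def by algebra
  then have "fps_XD N = N" using DE by simp
  moreover have "fps_nth N 1 = 1"
    using v0 v1 by (simp add: N_def fps_compose_nth mirror_fps_def)
  ultimately have N: "N = fps_X"
    using XD_eq_self[of N] by simp
  have "(- ((t4 - t0 ^ 5) ^ 2)) / (625 * t5 ^ 3) = 5 * inverse ((1 - z) * h ^ 2 * E ^ 3)"
  proof -
    \<comment> \<open>Both sides equal \<open>25 * t0^12 * (z - 1)^3 * E^3\<close>.\<close>
    have eq: "- ((t4 - t0 ^ 5) ^ 2) * ((1 - z) * h ^ 2 * E ^ 3) = 5 * (625 * t5 ^ 3)"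
    proof -
      have "5 * (625 * t5 ^ 3) = 25 * (5 * t5) ^ 3" by algebra
      also have "\<dots> = - ((t4 - t0 ^ 5) ^ 2) * ((1 - z) * h ^ 2 * E ^ 3)"
        unfolding t5 t4 h w_def by algebra
      finally show ?thesis ..
    qed
    have u1: "fps_nth ((1 - z) * h ^ 2 * E ^ 3) 0 \<noteq> 0"
      using z0 h0 E0 by (simp add: fps_nth_power_0)
    have u2: "fps_nth (625 * t5 ^ 3) 0 \<noteq> 0"
      using t50 by (simp add: fps_nth_power_0)
    show ?thesis
      unfolding fps_divide_unit[OF u2]
      using eq inverse_mult_eq_1[OF u1] inverse_mult_eq_1[OF u2] by algebra
  qed
  also have "\<dots> = yukawa_fps oo v"
  proof -
    have "inverse ((1 - 3125 * fps_X) * hyp_fps ^ 2 * (1 + fps_XD ratio_fps) ^ 3) oo v =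
       inverse ((1 - 3125 * fps_X) * hyp_fps ^ 2 * (1 + fps_XD ratio_fps) ^ 3 oo v)"
      by (rule fps_inverse_compose) (simp_all add: v0 fps_nth_power_0 fps_XD_nth)
    also have "(1 - 3125 * fps_X) * hyp_fps ^ 2 * (1 + fps_XD ratio_fps) ^ 3 oo v = (1 - z) * h ^ 2 * E ^ 3"
      unfolding s[symmetric] s_def h_def z
      by (simp only: fps_compose_mult_distrib[OF v0] fps_compose_power[OF v0] fps_compose_sub_distrib
        fps_compose_numeral fps_compose_1 fps_X_fps_compose_startby0[OF v0])
    finally show ?thesis
      by (simp add: yukawa_fps_def fps_compose_mult_distrib[OF v0])
  qed
  finally show ?thesis
    by (rule that[OF v0 N[unfolded N_def]])
qed

section \<open>Convergence and the analytic statement\<close>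

lemma fps_conv_radius_pos:
  fixes f :: "complex fps"
  assumes "\<And>n. norm (fps_nth f n) \<le> C * B ^ n" and "B > 0"
  shows "fps_conv_radius f > 0"
proof -
  define r where "r = 1 / (2 * B)"
  have "summable (\<lambda>n. fps_nth f n * of_real r ^ n)"
  proof (rule summable_comparison_test')
    show "summable (\<lambda>n. C * (1 / 2) ^ n)"
      by (intro summable_mult summable_geometric) simp
    show "norm (fps_nth f n * of_real r ^ n) \<le> C * (1 / 2) ^ n" for n
    proof -
      have "norm (fps_nth f n * of_real r ^ n) \<le> (C * B ^ n) * r ^ n"
        unfolding norm_mult norm_power norm_of_real using assms
        by (intro mult_mono) (auto simp: r_def intro: order_trans[OF norm_ge_zero])
      also have "\<dots> = C * (B * r) ^ n"
        by (simp add: power_mult_distrib)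
      also have "B * r = 1 / 2"
        using assms(2) by (simp add: r_def)
      finally show ?thesis .
    qed
  qed
  then have "conv_radius (fps_nth f) \<ge> norm (of_real r :: complex)"
    by (rule conv_radius_geI)
  moreover have "norm (of_real r :: complex) > 0"
    using assms(2) by (simp add: r_def)
  ultimately show ?thesis
    unfolding fps_conv_radius_def by (metis ereal_less(2) less_le_trans)
qed

text \<open>In the recurrence each factor \<open>5n + j\<close> is at most \<open>5 (n + 1)\<close>,
  so successive coefficients grow by at most \<open>5^5\<close>.\<close>

lemma norm_quintic_coeff_le: "norm (quintic_coeff n) \<le> 3125 ^ n"
proof (induction n)
  case 0
  then show ?case by (simp add: quintic_coeff_def)
next
  case (Suc n)
  define x where "x = real n"
  have nrm: "norm (5 * of_nat n + numeral k :: complex) = 5 * x + numeral k" for k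
    using norm_of_nat[of "5 * n + numeral k", where 'a = complex]
    by (simp only: of_nat_add of_nat_mult of_nat_numeral x_def)
  have nrm1: "norm (5 * of_nat n + 1 :: complex) = 5 * x + 1" "norm (of_nat n + 1 :: complex) = x + 1"
    using norm_of_nat[of "5 * n + 1", where 'a = complex] norm_of_nat[of "n + 1", where 'a = complex]
    by (simp_all only: of_nat_add of_nat_mult of_nat_numeral of_nat_1 x_def)
  have x: "x \<ge> 0" by (simp add: x_def)
  have "(x + 1) ^ 4 * norm (quintic_coeff (Suc n)) =
      5 * (5 * x + 1) * (5 * x + 2) * (5 * x + 3) * (5 * x + 4) * norm (quintic_coeff n)"
    using arg_cong[OF quintic_coeff_Suc[of n], of norm]
    by (simp only: norm_mult norm_power nrm nrm1 norm_numeral)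
  also have "\<dots> \<le> 5 * (5 * (x + 1)) * (5 * (x + 1)) * (5 * (x + 1)) * (5 * (x + 1)) * 3125 ^ n"
    using x Suc.IH by (intro mult_mono) auto
  also have "\<dots> = (x + 1) ^ 4 * 3125 ^ Suc n"
  proof -
    have "5 * (5 * c) * (5 * c) * (5 * c) * (5 * c) * b = c ^ 4 * (3125 * b)" for b c :: real
      by algebra
    then show ?thesis by (simp only: power_Suc)
  qed
  finally show ?case
    using x by (simp add: mult_le_cancel_left)
qed

lemma norm_harmonic_gap_le: "norm (harmonic_gap n) \<le> 4 * real n"
proof -
  have "norm (harmonic_gap n) \<le> (\<Sum>k = Suc n..5 * n. norm (1 / of_nat k :: complex))"
    unfolding harmonic_gap_def by (rule norm_sum)
  also have "\<dots> \<le> of_nat (card {Suc n..5 * n}) * 1"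
    by (rule sum_bounded_above) (simp add: norm_divide)
  finally show ?thesis by simp
qed

lemma hyp_fps_conv_radius: "fps_conv_radius hyp_fps > 0"
  by (rule fps_conv_radius_pos[where C = 1 and B = 3125]) (simp_all add: hyp_fps_def norm_quintic_coeff_le)

lemma log_fps_conv_radius: "fps_conv_radius log_fps > 0"
proof (rule fps_conv_radius_pos)
  fix n
  \<comment> \<open>Absorbing the linear harmonic bound into \<open>2^n\<close> doubles the growth
    rate 3125.\<close>
  have "real n \<le> 2 ^ n"
    by (simp add: less_imp_le of_nat_less_two_power)
  then have "norm (harmonic_gap n) \<le> 4 * 2 ^ n"
    using norm_harmonic_gap_le[of n] by linarith
  then have "norm (quintic_coeff n) * norm (harmonic_gap n) \<le> 3125 ^ n * (4 * 2 ^ n)"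
    by (intro mult_mono norm_quintic_coeff_le) auto
  also have "\<dots> = 4 * 6250 ^ n"
    by (simp flip: power_mult_distrib)
  finally show "norm (fps_nth log_fps n) \<le> 20 * 6250 ^ n"
    by (simp add: log_fps_def norm_mult mult.commute)
qed simp

section \<open>The periods and the mirror map as analytic functions\<close>

lemma hyp0_eq_eval_fps: "hyp0 u = eval_fps hyp_fps u"
  by (simp add: hyp0_def eval_fps_def hyp_fps_def quintic_coeff_def)

lemma hyp1_eq_eval_fps:
  assumes "norm u < fps_conv_radius log_fps"
  shows "hyp1 u = Ln u * eval_fps hyp_fps u + eval_fps log_fps u"
proof -
  let ?f = "\<lambda>m. fact (5 * m) / fact m ^ 5 * (\<Sum>k = Suc m..5 * m. 1 / of_nat k) * u ^ m"
  have eq: "fps_nth log_fps m * u ^ m = 5 * ?f m" for m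
    by (simp add: log_fps_def quintic_coeff_def harmonic_gap_def)
  have "summable (\<lambda>m. 5 * ?f m)"
    using summable_fps[OF assms] by (simp only: eq)
  then have "summable ?f"
    by (subst (asm) summable_cmult_iff) simp
  then have "eval_fps log_fps u = 5 * (\<Sum>m. ?f m)"
    unfolding eval_fps_def eq by (rule suminf_mult)
  then show ?thesis by (simp add: hyp1_def hyp0_eq_eval_fps)
qed

definition ratio_fun :: "complex \<Rightarrow> complex" where
  "ratio_fun u = eval_fps log_fps u / eval_fps hyp_fps u"

definition mirror_fun :: "complex \<Rightarrow> complex" where
  "mirror_fun u = u * exp (ratio_fun u)"

definition yukawa_fun :: "complex \<Rightarrow> complex" where
  "yukawa_fun u = 5 * inverse ((1 - 3125 * u) * eval_fps hyp_fps u ^ 2 * (1 + u * deriv ratio_fun u) ^ 3)"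

lemma ratio_fun_expansion: "ratio_fun has_fps_expansion ratio_fps"
proof -
  have "(\<lambda>u. eval_fps log_fps u * inverse (eval_fps hyp_fps u)) has_fps_expansion ratio_fps"
    unfolding ratio_fps_def
    by (intro has_fps_expansion_mult has_fps_expansion_inverse eval_fps_has_fps_expansion
      hyp_fps_conv_radius log_fps_conv_radius) simp
  then show ?thesis unfolding ratio_fun_def[abs_def] divide_inverse .
qed

lemma mirror_fun_expansion: "mirror_fun has_fps_expansion mirror_fps"
proof -
  have "(\<lambda>u. u * (exp \<circ> ratio_fun) u) has_fps_expansion mirror_fps"
    unfolding mirror_fps_def
    by (intro has_fps_expansion_mult has_fps_expansion_fps_X has_fps_expansion_compose
      has_fps_expansion_exp1 ratio_fun_expansion) simp
  then show ?thesis by (simp add: mirror_fun_def[abs_def])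
qed

lemma yukawa_fun_expansion: "yukawa_fun has_fps_expansion yukawa_fps"
  unfolding yukawa_fun_def[abs_def] yukawa_fps_def fps_XD_def comp_def
  by (intro has_fps_expansion_mult has_fps_expansion_inverse has_fps_expansion_power has_fps_expansion_add
    has_fps_expansion_diff has_fps_expansion_1 has_fps_expansion_numeral has_fps_expansion_fps_X
    has_fps_expansion_deriv eval_fps_has_fps_expansion hyp_fps_conv_radius ratio_fun_expansion)
    (simp add: fps_nth_power_0)

text \<open>The formal inverse converges: a holomorphic local inverse has some expansion
  \<open>G\<close> with \<open>G oo F = fps_X\<close>, and associativity gives
  \<open>G = G oo (F oo v) = v\<close>.\<close>

lemma fps_expansion_local_inverse:
  fixes f :: "complex \<Rightarrow> complex"
  assumes f: "f has_fps_expansion F" and F0: "fps_nth F 0 = 0" and F1: "fps_nth F 1 \<noteq> 0"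
    and inv: "F oo v = fps_X" and v0: "fps_nth v 0 = 0"
  obtains g where "g has_fps_expansion v" and "\<forall>\<^sub>F u in nhds 0. g (f u) = u"
proof -
  obtain S where S: "open S" "0 \<in> S" "f holomorphic_on S"
    using has_fps_expansion_imp_holomorphic[OF f] by blast
  have f0: "f 0 = 0"
    using has_fps_expansion_imp_0_eq_fps_nth_0[OF f] F0 by simp
  have "deriv f 0 \<noteq> 0"
    using fps_nth_fps_expansion[OF f, of 1] F1 by simp
  then obtain r where r: "r > 0" "ball 0 r \<subseteq> S" "inj_on f (ball 0 r)" "open (f ` ball 0 r)"
    using has_complex_derivative_locally_invertible[OF S(3,2,1)] by metis
  have hol: "f holomorphic_on ball 0 r"
    using S(3) r(2) holomorphic_on_subset by blast
  obtain g where g: "g holomorphic_on (f ` ball 0 r)" "\<And>u. u \<in> ball 0 r \<Longrightarrow> g (f u) = u"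
    using holomorphic_has_inverse[OF hol open_ball r(3)] by metis
  have gf: "\<forall>\<^sub>F u in nhds 0. g (f u) = u"
  proof (rule eventually_mono)
    show "\<forall>\<^sub>F u in nhds 0. u \<in> ball 0 r"
      using r(1) by (intro eventually_nhds_in_open) auto
  qed (rule g(2))
  have "0 \<in> f ` ball 0 r"
    using f0 r(1) by (metis centre_in_ball imageI)
  then have "g analytic_on {0}"
    using g(1) r(4) analytic_at by blast
  then obtain G where G: "g has_fps_expansion G"
    using analytic_at_imp_has_fps_expansion_0 by blast
  have gF: "(g \<circ> f) has_fps_expansion (G oo F)"
    using G f F0 by (rule has_fps_expansion_compose)
  then have "\<forall>\<^sub>F u in nhds 0. eval_fps (G oo F) u = (g \<circ> f) u"
    by (simp add: has_fps_expansion_def)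
  then have "\<forall>\<^sub>F u in nhds 0. eval_fps (G oo F) u = u"
    using gf by eventually_elim simp
  then have "(\<lambda>u. u) has_fps_expansion (G oo F)"
    using gF by (simp add: has_fps_expansion_def)
  then have "G oo F = fps_X"
    using has_fps_expansion_fps_X by (rule fps_expansion_unique_complex)
  then have "G = v"
    using fps_compose_assoc[OF v0 F0, of G] inv fps_X_fps_compose_startby0[OF v0] by simp
  with G gf show ?thesis by (intro that) auto
qed

text \<open>Needed to differentiate the formula for \<open>tau_map\<close>: it must hold near each
  \<open>z\<close>, not only at \<open>z\<close>. The point \<open>a\<close> is kept out of
  \<open>A\<close> because the filter says nothing about \<open>a\<close> itself.\<close>

lemma eventually_at_within_open_nhds:
  fixes A :: "'a::t1_space set"
  assumes "\<forall>\<^sub>F z in at a within A. P z" and "open A" and "a \<notin> A"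
  shows "\<forall>\<^sub>F z in at a within A. \<forall>\<^sub>F x in nhds z. P x"
proof -
  obtain S where S: "open S" "a \<in> S" "\<And>z. z \<in> S \<Longrightarrow> z \<in> A \<Longrightarrow> P z"
    using assms(1,3) unfolding eventually_at_topological by metis
  have "\<forall>\<^sub>F x in nhds z. P x" if "z \<in> S" "z \<in> A" for z
  proof (rule eventually_mono)
    show "\<forall>\<^sub>F x in nhds z. x \<in> S \<inter> A"
      using S(1) assms(2) that by (intro eventually_nhds_in_open) auto
  qed (use S(3) in auto)
  then show ?thesis
    unfolding eventually_at_topological using S(1,2) by blast
qed

section \<open>The q-expansion of the Yukawa coupling\<close>

theorem theorem1:
  fixes t0 t1 t2 t3 t4 t5 t6 :: "complex fps"
    and P1 P2 :: "complex \<Rightarrow> complex"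
  assumes "quintic_system t0 t1 t2 t3 t4 t5 t6"
    and "fps_nth t0 0 = 1/5" and "fps_nth t0 1 = 24"
    and "fps_nth t4 0 = 0" and "fps_nth t5 0 \<noteq> 0"
    and "\<forall>\<^sub>F z in at 0 within - \<real>\<^sub>\<le>\<^sub>0.
           P1 z = (2 * of_real pi * \<i>) ^ 3 / 5 ^ 4 * hyp0 (z / 5 ^ 5)"
    and "\<forall>\<^sub>F z in at 0 within - \<real>\<^sub>\<le>\<^sub>0.
           P2 z = (2 * of_real pi * \<i>) ^ 2 / 5 ^ 4 * hyp1 (z / 5 ^ 5)"
  shows "has_q_expansion (q_map P1 P2) (yukawa P1 P2)
           ((- ((t4 - t0 ^ 5) ^ 2)) / (625 * t5 ^ 3))"
proof -
  obtain v where v: "fps_nth v 0 = 0" "mirror_fps oo v = fps_X"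
    "(- ((t4 - t0 ^ 5) ^ 2)) / (625 * t5 ^ 3) = yukawa_fps oo v"
    using quintic_system_mirror_map[OF assms(1-5)] by metis
  have "fps_nth mirror_fps 0 = 0" "fps_nth mirror_fps 1 \<noteq> 0"
    by (simp_all add: mirror_fps_def)
  then obtain g where g: "g has_fps_expansion v" "\<forall>\<^sub>F u in nhds 0. g (mirror_fun u) = u"
    using fps_expansion_local_inverse[OF mirror_fun_expansion _ _ v(2,1)] by metis
  \<comment> \<open>The witness: go from \<open>q\<close> back to \<open>u\<close> by the inverse
    mirror map, then evaluate the coupling in \<open>u\<close>.\<close>
  have K: "(yukawa_fun \<circ> g) has_fps_expansion (yukawa_fps oo v)"
    using yukawa_fun_expansion g(1) v(1) by (rule has_fps_expansion_compose)
  define p where "p = 2 * of_real pi * \<i>"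
  have p: "p \<noteq> 0" by (simp add: p_def)
  let ?F = "at 0 within - \<real>\<^sub>\<le>\<^sub>0 :: complex filter"
  have scale: "\<forall>\<^sub>F z in ?F. P (z / 3125)" if "\<forall>\<^sub>F u in nhds 0. P u" for P
  proof -
    have "((\<lambda>z::complex. z / 3125) \<longlongrightarrow> 0 / 3125) ?F"
      by (intro tendsto_intros) simp
    then show ?thesis
      using eventually_compose_filterlim[OF that] by simp
  qed
  have hyp_nz: "\<forall>\<^sub>F u in nhds 0. eval_fps hyp_fps u \<noteq> 0"
  proof -
    have "isCont (eval_fps hyp_fps) 0"
      using has_fps_expansion_imp_continuous[OF eval_fps_has_fps_expansion[OF hyp_fps_conv_radius]] .
    then have "(eval_fps hyp_fps \<longlongrightarrow> eval_fps hyp_fps 0) (nhds 0)"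
      unfolding isCont_def tendsto_at_iff_tendsto_nhds .
    then show ?thesis
      by (rule tendsto_imp_eventually_ne) (simp add: eval_fps_at_0)
  qed
  have conv: "\<forall>\<^sub>F u in nhds (0::complex). norm u < fps_conv_radius log_fps"
    using eventually_nhds_in_open[of "eball 0 (fps_conv_radius log_fps)" "0::complex"] log_fps_conv_radius
    by (simp add: zero_ereal_def)
  have diff: "\<forall>\<^sub>F u in nhds 0. ratio_fun field_differentiable at u"
  proof -
    obtain S where S: "open S" "0 \<in> S" "ratio_fun holomorphic_on S"
      using has_fps_expansion_imp_analytic_0[OF ratio_fun_expansion] analytic_at by metis
    show ?thesis
      by (rule eventually_mono[OF eventually_nhds_in_open[OF S(1,2)]])
        (rule holomorphic_on_imp_differentiable_at[OF S(3,1)])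
  qed
  have slit: "open (- \<real>\<^sub>\<le>\<^sub>0 :: complex set)"
    using closed_nonpos_Reals_complex by (rule open_Compl)
  \<comment> \<open>The prefactors of the periods leave \<open>1 / p\<close>, which the exponent in
    \<open>q_map\<close> cancels.\<close>
  have tau: "\<forall>\<^sub>F z in ?F. tau_map P1 P2 z = (Ln (z / 3125) + ratio_fun (z / 3125)) / p"
    using assms(6,7) scale[OF hyp_nz] scale[OF conv]
  proof eventually_elim
    case (elim z)
    define h where "h = eval_fps hyp_fps (z / 3125)"
    define l where "l = eval_fps log_fps (z / 3125)"
    have P1: "P1 z = p ^ 3 / 5 ^ 4 * h"
      using elim(1) by (simp add: p_def h_def hyp0_eq_eval_fps)
    have P2: "P2 z = p ^ 2 / 5 ^ 4 * (Ln (z / 3125) * h + l)"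
      using elim(2,4) by (simp add: p_def h_def l_def hyp1_eq_eval_fps)
    have h: "h \<noteq> 0" using elim(3) by (simp add: h_def)
    have "p ^ 2 / 5 ^ 4 * b / (p ^ 3 / 5 ^ 4 * h) = b / h / p" for b
      using p h by (simp add: divide_simps) (simp add: eval_nat_numeral)
    then have "tau_map P1 P2 z = (Ln (z / 3125) * h + l) / h / p"
      unfolding tau_map_def P1 P2 .
    also have "(Ln (z / 3125) * h + l) / h = Ln (z / 3125) + ratio_fun (z / 3125)"
      using h by (simp add: add_divide_distrib ratio_fun_def h_def l_def)
    finally show ?case .
  qed
  have tau_nhds: "\<forall>\<^sub>F z in ?F. \<forall>\<^sub>F x in nhds z.
      tau_map P1 P2 x = (Ln (x / 3125) + ratio_fun (x / 3125)) / p"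
    by (rule eventually_at_within_open_nhds[OF tau slit]) simp
  have z_slit: "\<forall>\<^sub>F z in ?F. z \<in> - \<real>\<^sub>\<le>\<^sub>0"
    by (simp add: eventually_at_filter)
  have "\<forall>\<^sub>F z in ?F. yukawa P1 P2 z = (yukawa_fun \<circ> g) (q_map P1 P2 z)"
    using tau tau_nhds assms(6) scale[OF g(2)] scale[OF diff] scale[OF hyp_nz] z_slit
  proof eventually_elim
    case (elim z)
    have z: "z \<noteq> 0" using elim(7) by auto
    have slit': "z / 3125 \<notin> \<real>\<^sub>\<le>\<^sub>0"
      using elim(7) by (auto simp: complex_nonpos_Reals_iff)
    \<comment> \<open>The exponential undoes the principal logarithm, so the branch
      disappears.\<close>
    have "q_map P1 P2 z = mirror_fun (z / 3125)"
      using p z unfolding q_map_def elim(1) p_def[symmetric] by (simp add: exp_add mirror_fun_def)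
    then have q: "(yukawa_fun \<circ> g) (q_map P1 P2 z) = yukawa_fun (z / 3125)"
      using elim(4) by (simp only: comp_apply)
    have lin: "((\<lambda>z. z / 3125) has_field_derivative 1 / 3125) (at z)"
      by (auto intro!: derivative_eq_intros)
    have "((\<lambda>z. Ln (z / 3125)) has_field_derivative inverse (z / 3125) * (1 / 3125)) (at z)"
      by (rule DERIV_chain2[where g = "\<lambda>z. z / 3125", OF has_field_derivative_Ln[OF slit'] lin])
    moreover have "((\<lambda>z. ratio_fun (z / 3125)) has_field_derivative deriv ratio_fun (z / 3125) * (1 / 3125)) (at z)"
      by (rule DERIV_chain2[where g = "\<lambda>z. z / 3125", OF field_differentiable_derivI[OF elim(5)] lin])
    ultimately have "((\<lambda>z. (Ln (z / 3125) + ratio_fun (z / 3125)) / p) has_field_derivative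
       (inverse (z / 3125) * (1 / 3125) + deriv ratio_fun (z / 3125) * (1 / 3125)) / p) (at z)"
      by (intro DERIV_cdivide DERIV_add)
    moreover have "inverse (z / 3125) * (1 / 3125) + deriv ratio_fun (z / 3125) * (1 / 3125) =
       1 / z + deriv ratio_fun (z / 3125) / 3125"
      by (simp add: inverse_eq_divide)
    ultimately have "((\<lambda>z. (Ln (z / 3125) + ratio_fun (z / 3125)) / p) has_field_derivative
       (1 / z + deriv ratio_fun (z / 3125) / 3125) / p) (at z)"
      by simp
    then have deriv: "deriv (tau_map P1 P2) z = (1 / z + deriv ratio_fun (z / 3125) / 3125) / p"
      unfolding deriv_cong_ev[OF elim(2) refl] by (rule DERIV_imp_deriv)
    \<comment> \<open>\<open>W\<close> is \<open>(u / q) dq/du\<close> at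
      \<open>u = z / 3125\<close>; rescaling the variable does not change
      \<open>z d/dz\<close>.\<close>
    define W where "W = 1 + z / 3125 * deriv ratio_fun (z / 3125)"
    define H where "H = eval_fps hyp_fps (z / 3125)"
    have W: "z * deriv (tau_map P1 P2) z = W / p"
      using z p deriv by (simp add: W_def field_simps)
    have P1: "P1 z = p ^ 3 / 5 ^ 4 * H"
      using elim(3) by (simp add: p_def H_def hyp0_eq_eval_fps)
    define M where "M = (1 - z) * H ^ 2 * W ^ 3"
    have "(W / p) ^ 3 * (z - 1) * (p ^ 3 / 5 ^ 4 * H) ^ 2 = - (p ^ 3 / 5 ^ 8) * M"
      using p by (simp add: M_def field_simps)
    \<comment> \<open>The powers of 5 leave \<open>5^8 / 5^7 = 5\<close>; for \<open>M = 0\<close>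
      both sides are 0 by the convention on division.\<close>
    moreover have "- (1 / 5 ^ 4) * (p / 5) ^ 3 / (- (p ^ 3 / 5 ^ 8) * M) = 5 * inverse M"
      using p by (cases "M = 0") (simp_all add: field_simps)
    ultimately have "yukawa P1 P2 z = 5 * inverse M"
      unfolding yukawa_def W P1 p_def[symmetric] by simp
    then have "yukawa P1 P2 z = yukawa_fun (z / 3125)"
      by (simp add: yukawa_fun_def M_def W_def H_def)
    then show ?case using q by simp
  qed
  with K show ?thesis
    unfolding has_q_expansion_def v(3) by (intro exI[of _ "yukawa_fun \<circ> g"] conjI)
qed

end
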